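(* Let $f:\mathbb{R}^n\times\mathbb{R}^m\to\mathbb{R}^n$ be a function (not assumed continuous or differentiable) with $f(0,0)=0$, and consider the discrete-time time-invariant system $x(t+1)=f(x(t),u(t))$, $t\in\mathbb{Z}_{\ge 0}$, with state $x(t)\in\mathbb{R}^n$ and input $u(t)\in\mathbb{R}^m$. Let $N>0$ be an integer. Then the system is $N$-step controllable to the origin if and only if it is $N$-step stabilizable by a state feedback controller.
   Context: For an initial state $x_0\in\mathbb{R}^n$ and an input sequence $u=(u(0),u(1),\dots)$ defined at least on times $0,\dots,t-1$, $\phi(t,0,x_0,u)$ denotes the trajectory of the system: $\phi(0,0,x_0,u)=x_0$ and $\phi(t,0,x_0,u)=f(\phi(t-1,0,x_0,u),u(t-1))$ for $t\ge 1$. $N$-step controllable to the origin: for every $x_0\in\mathbb{R}^n$ there exists a finite input sequence $(u(0),\dots,u(N-1))$ in $\mathbb{R}^m$ such that $\phi(N,0,x_0,u)=0$. A state feedback controller (control law) is a function $\upsilon:\mathbb{R}^n\to\mathbb{R}^m$, time-invariant and possibly discontinuous. The closed-loop trajectory $\phi(t,0,x_0;\upsilon(x))$ is the sequence $x_t$ with initial value $x_0$ and $x_{t+1}=f(x_t,\upsilon(x_t))$. $N$-step stabilizable by a state feedback controller (globally): there is a control law $\upsilon:\mathbb{R}^n\to\mathbb{R}^m$ such that for every $x_0\in\mathbb{R}^n$, $\phi(N,0,x_0;\upsilon(x))=0$. *)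

theory Defs
  imports "HOL-Analysis.Analysis"
begin

text \<open>
  The finite input sequence \<open>(u(0), \<dots>, u(t - 1))\<close> is represented by a total function on
  \<open>nat\<close>; by \<open>open_loop_cong\<close> its values from time \<open>t\<close> on do not affect the state at time \<open>t\<close>.
  The initial time is always \<open>0\<close> and is therefore not an argument.
\<close>

primrec open_loop ::
  "(real ^ 'n \<Rightarrow> real ^ 'm \<Rightarrow> real ^ 'n) \<Rightarrow> real ^ 'n \<Rightarrow> (nat \<Rightarrow> real ^ 'm) \<Rightarrow> nat \<Rightarrow> real ^ 'n"
where
  "open_loop f x0 u 0 = x0"
| "open_loop f x0 u (Suc t) = f (open_loop f x0 u t) (u t)"

lemma open_loop_cong:
  assumes "\<And>s. s < t \<Longrightarrow> u s = v s"
  shows "open_loop f x0 u t = open_loop f x0 v t"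
  using assms by (induction t) auto

primrec closed_loop ::
  "(real ^ 'n \<Rightarrow> real ^ 'm \<Rightarrow> real ^ 'n) \<Rightarrow> (real ^ 'n \<Rightarrow> real ^ 'm) \<Rightarrow> real ^ 'n \<Rightarrow> nat \<Rightarrow> real ^ 'n"
where
  "closed_loop f k x0 0 = x0"
| "closed_loop f k x0 (Suc t) = f (closed_loop f k x0 t) (k (closed_loop f k x0 t))"

definition controllable_to_origin ::
  "nat \<Rightarrow> (real ^ 'n \<Rightarrow> real ^ 'm \<Rightarrow> real ^ 'n) \<Rightarrow> bool"
where
  "controllable_to_origin N f \<longleftrightarrow> (\<forall>x0. \<exists>u. open_loop f x0 u N = 0)"

definition feedback_stabilizable ::
  "nat \<Rightarrow> (real ^ 'n \<Rightarrow> real ^ 'm \<Rightarrow> real ^ 'n) \<Rightarrow> bool"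
where
  "feedback_stabilizable N f \<longleftrightarrow> (\<exists>k. \<forall>x0. closed_loop f k x0 N = 0)"

end

theory Submission
  imports Defs
begin

text \<open>
  A feedback yields an open-loop input by recording the inputs it applies, so only the passage from
  controllability to feedback is substantial. The inputs that steer different initial states to the
  origin need not fit together: two such trajectories may pass through the same state at different
  times and continue differently. Time-optimal inputs resolve this conflict. Let \<open>T x\<close> be the least
  number of steps in which \<open>x\<close> can be steered to the origin. The first input of a time-optimal
  sequence from \<open>x \<noteq> 0\<close> leads to a state with a strictly smaller \<open>T\<close>, and which input does this
  depends on \<open>x\<close> alone; hence choosing one such input for each \<open>x \<noteq> 0\<close>, and the input \<open>0\<close> at the
  origin, defines a time-invariant feedback. Along its trajectories \<open>T\<close> decreases by at least one in
  every step until the origin is reached (\<open>min_steering_time_decreases\<close>), and the trajectory stays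
  there because \<open>f 0 0 = 0\<close>. Since \<open>T\<close> is bounded by \<open>N\<close>, every trajectory is at the origin at
  time \<open>N\<close>.
\<close>

definition min_steering_time ::
  "(real ^ 'n \<Rightarrow> real ^ 'm \<Rightarrow> real ^ 'n) \<Rightarrow> real ^ 'n \<Rightarrow> nat"
where
  "min_steering_time f x = (LEAST t. \<exists>u. open_loop f x u t = 0)"

lemma min_steering_time_le:
  assumes "open_loop f x u t = 0"
  shows "min_steering_time f x \<le> t"
  unfolding min_steering_time_def using assms by (blast intro: Least_le)

lemma min_steering_time_attained:
  assumes "open_loop f x u t = 0"
  shows "\<exists>v. open_loop f x v (min_steering_time f x) = 0"
  unfolding min_steering_time_def using assms
  by (intro LeastI[of "\<lambda>s. \<exists>v. open_loop f x v s = 0"]) blast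

lemma open_loop_Suc_shift:
  "open_loop f x u (Suc t) = open_loop f (f x (u 0)) (\<lambda>s. u (Suc s)) t"
  by (induction t) auto

text \<open>
  Dynamic programming: the tail of a time-optimal input steers the successor state to the origin
  in one step less. For \<open>x \<noteq> 0\<close> the optimal input has a first entry, since \<open>0\<close> steps leave \<open>x\<close> in
  place.
\<close>

lemma min_steering_time_decreases:
  assumes "open_loop f x u t = 0" and "x \<noteq> 0"
  shows "\<exists>w. min_steering_time f (f x w) < min_steering_time f x"
proof -
  obtain v where v: "open_loop f x v (min_steering_time f x) = 0"
    using min_steering_time_attained[OF assms(1)] by blast
  with \<open>x \<noteq> 0\<close> obtain s where s: "min_steering_time f x = Suc s"
    by (cases "min_steering_time f x") auto
  then have "open_loop f (f x (v 0)) (\<lambda>r. v (Suc r)) s = 0"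
    using v by (simp only: open_loop_Suc_shift)
  then have "min_steering_time f (f x (v 0)) \<le> s"
    by (rule min_steering_time_le)
  then show ?thesis
    using s by (intro exI[of _ "v 0"]) simp
qed

lemma closed_loop_eq_open_loop:
  "closed_loop f k x t = open_loop f x (\<lambda>s. k (closed_loop f k x s)) t"
  by (induction t) auto

lemma feedback_stabilizable_imp_controllable:
  "feedback_stabilizable N f \<Longrightarrow> controllable_to_origin N f"
  unfolding feedback_stabilizable_def controllable_to_origin_def
  using closed_loop_eq_open_loop by metis

lemma controllable_imp_feedback_stabilizable:
  assumes equilibrium: "f 0 0 = 0"
    and controllable: "controllable_to_origin N f"
  shows "feedback_stabilizable N f"
proof -
  let ?T = "min_steering_time f"
  have steerable: "\<exists>u. open_loop f x u N = 0" for x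
    using controllable by (simp add: controllable_to_origin_def)
  have T_le: "?T x \<le> N" for x
    using steerable min_steering_time_le by blast
  have T_zero: "?T 0 = 0"
    using min_steering_time_le[of f 0 _ 0] by simp
  have T_eq_0: "x = 0" if "?T x = 0" for x
    using steerable[of x] min_steering_time_attained[of f x] that by fastforce
  have "\<exists>w. if x = 0 then w = 0 else ?T (f x w) < ?T x" for x
    using steerable[of x] min_steering_time_decreases[of f x] by auto
  then obtain k where k: "\<And>x. if x = 0 then k x = 0 else ?T (f x (k x)) < ?T x"
    by metis
  have "?T (closed_loop f k x t) \<le> N - t" for x t
  proof (induction t)
    case 0
    show ?case by (simp add: T_le)
  next
    case (Suc t)
    let ?y = "closed_loop f k x t"
    show ?case
    proof (cases "?y = 0")
      case True
      then show ?thesis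
        using k[of 0] by (simp add: equilibrium T_zero)
    next
      case False
      then have "?T (f ?y (k ?y)) < ?T ?y"
        using k[of ?y] by simp
      with Suc.IH show ?thesis by simp
    qed
  qed
  then have "closed_loop f k x N = 0" for x
    using T_eq_0 by (metis diff_self_eq_0 le_zero_eq)
  then show ?thesis
    unfolding feedback_stabilizable_def by blast
qed

theorem lemma1:
  fixes f :: "real ^ 'n \<Rightarrow> real ^ 'm \<Rightarrow> real ^ 'n"
    and N :: nat
  assumes "f 0 0 = 0"
    and "N > 0"
  shows "controllable_to_origin N f \<longleftrightarrow> feedback_stabilizable N f"
  using controllable_imp_feedback_stabilizable[of f, OF assms(1)]
    feedback_stabilizable_imp_controllable by blast

end
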